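(* Let $A\geq 2$ be an integer and let $(\tau_b)_{b\in B}$ be the affine iterated function system on $\mathbb{R}$ given by $\tau_b(x)=A^{-1}(x+b)$, $b\in B$. Suppose $A=a^p$ for some integers $a\geq 2$ and $p\geq 2$, and $$B=a^{n_0p}C\oplus a^{n_1p+1}C\oplus\dots\oplus a^{n_{p-1}p+p-1}C,\quad\text{where } C=\{0,\dots,a-1\},$$ for some non-negative integers $n_0,\dots,n_{p-1}$. Then the invariant measure $\mu_B$ has the form $\mu_B=\mu_{[0,1]}\ast\delta_F$, where $\mu_{[0,1]}$ is the Lebesgue measure on $[0,1]$ and $F$ is a finite set of integers.
   Context: The invariant measure $\mu_B$ is the unique Borel probability measure on $\mathbb{R}$ such that $\int f\,d\mu_B=\frac{1}{\#B}\sum_{b\in B}\int f\circ\tau_b\,d\mu_B$ for all $f\in C_c(\mathbb{R})$. For a finite set $F$, $\delta_F=\frac{1}{\#F}\sum_{x\in F}\delta_x$ ($\delta_x$ the Dirac measure at $x$), and $\ast$ denotes convolution of measures. The notation $P\oplus Q=R$ (similarly for several summands) means $R=P+Q$ and every $r\in R$ can be written uniquely as $r=p+q$ with $p\in P$, $q\in Q$. *)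

theory Defs
  imports "HOL-Probability.Probability"
begin

definition ifs_map :: "int \<Rightarrow> real \<Rightarrow> real \<Rightarrow> real"
  where "ifs_map A b x = inverse (of_int A) * (x + b)"

text \<open>The test functions range over the real-valued members of \<open>C\<^sub>c(\<real>)\<close>.\<close>

definition is_invariant_measure :: "int \<Rightarrow> real set \<Rightarrow> real measure \<Rightarrow> bool"
  where "is_invariant_measure A B \<mu> \<longleftrightarrow>
    sets \<mu> = sets borel \<and> prob_space \<mu> \<and>
    (\<forall>f :: real \<Rightarrow> real.
       continuous_on UNIV f \<and> compact (closure {x. f x \<noteq> 0}) \<longrightarrow>
       (\<integral>x. f x \<partial>\<mu>) = 1 / real (card B) * (\<Sum>b\<in>B. \<integral>x. (f \<circ> ifs_map A b) x \<partial>\<mu>))"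

definition invariant_measure :: "int \<Rightarrow> real set \<Rightarrow> real measure"
  where "invariant_measure A B = (THE \<mu>. is_invariant_measure A B \<mu>)"

text \<open>The measure \<open>\<mu>\<^bsub>[0,1]\<^esub>\<close> is a Borel measure on all of \<open>\<real>\<close>, so that it can be convolved.\<close>

definition lebesgue_01 :: "real measure"
  where "lebesgue_01 = density lborel (indicator {0..1})"

definition uniform_dirac :: "real set \<Rightarrow> real measure"
  where "uniform_dirac F =
    measure_of UNIV (sets borel) (\<lambda>X. 1 / of_nat (card F) * (\<Sum>x\<in>F. emeasure (return borel x) X))"

text \<open>\<open>measure_of\<close> yields the null measure unless the given set function is a measure;
  the following shows that it is one for nonempty finite \<open>F\<close>.\<close>

lemma sets_uniform_dirac [simp]: "sets (uniform_dirac F) = sets borel"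
  unfolding uniform_dirac_def
  by (metis sets.sigma_sets_eq sets_measure_of sets.space_closed space_borel)

lemma emeasure_uniform_dirac:
  assumes "finite F" "F \<noteq> {}" "X \<in> sets borel"
  shows "emeasure (uniform_dirac F) X =
    1 / of_nat (card F) * (\<Sum>x\<in>F. emeasure (return borel x) X)"
proof (rule emeasure_measure_of[OF uniform_dirac_def])
  show "countably_additive (sets (uniform_dirac F))
     (\<lambda>X. 1 / of_nat (card F) * (\<Sum>x\<in>F. emeasure (return borel x) X))"
  proof (rule countably_additiveI)
    fix Y :: "nat \<Rightarrow> real set"
    assume Y: "range Y \<subseteq> sets (uniform_dirac F)" "disjoint_family Y"
    have "(\<Sum>i. \<Sum>x\<in>F. emeasure (return borel x) (Y i)) =
        (\<Sum>x\<in>F. \<Sum>i. emeasure (return borel x) (Y i))"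
      by (rule suminf_sum) simp
    also have "\<dots> = (\<Sum>x\<in>F. emeasure (return borel x) (\<Union>i. Y i))"
      using Y by (intro sum.cong refl suminf_emeasure) auto
    finally show "(\<Sum>i. 1 / of_nat (card F) * (\<Sum>x\<in>F. emeasure (return borel x) (Y i))) =
        1 / of_nat (card F) * (\<Sum>x\<in>F. emeasure (return borel x) (\<Union>i. Y i))"
      by simp
  qed
qed (use assms in \<open>auto simp: positive_def\<close>)

text \<open>\<open>is_direct_sum I P R\<close> expresses \<open>R = \<Oplus>i\<in>I. P i\<close> for subsets of an abelian monoid.\<close>

definition is_direct_sum :: "'i set \<Rightarrow> ('i \<Rightarrow> 'a::comm_monoid_add set) \<Rightarrow> 'a set \<Rightarrow> bool"
  where "is_direct_sum I P R \<longleftrightarrow>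
    R = {\<Sum>i\<in>I. x i | x. x \<in> Pi\<^sub>E I P} \<and>
    (\<forall>r\<in>R. \<exists>!x. x \<in> Pi\<^sub>E I P \<and> r = (\<Sum>i\<in>I. x i))"

end

theory Submission
  imports Defs
begin

text \<open>
  A random variable with distribution \<open>\<mu>\<^sub>B\<close> is a sum of independent terms \<open>a\<^sup>e c\<^sub>e\<close> with \<open>c\<^sub>e\<close> uniform on
  \<open>{0, \<dots>, a - 1}\<close>. Every negative exponent \<open>e\<close> occurs exactly once, which yields the Lebesgue
  measure on \<open>[0,1]\<close>, and the nonnegative exponents that occur are the \<open>e\<close> with
  \<open>e div p < n (e mod p)\<close>, which yields \<open>\<delta>\<^sub>F\<close>. Accordingly, we let \<open>F\<close> be the set of the
  integers with digits at these exponents only. Since the digits of \<open>B\<close> are those with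
  \<open>e div p = n (e mod p)\<close>, we get \<open>B \<oplus> F = {0, \<dots>, A - 1} \<oplus> A F\<close>, and this identity is the
  invariance of \<open>\<mu>\<^bsub>[0,1]\<^esub> \<star> \<delta>\<^sub>F\<close>. Uniqueness of the invariant measure follows by iterating the
  functional equation of its characteristic function towards \<open>0\<close>.
\<close>

section \<open>Base-\<open>a\<close> digit sums with prescribed exponents\<close>

text \<open>For finite \<open>E\<close> and \<open>a >= 2\<close>, these are the naturals whose
  base-\<open>a\<close> expansion is supported in \<open>E\<close>. Extensional digit functions make
  the digits unique, so that such sets can be counted.\<close>

definition digit_sums :: "nat \<Rightarrow> nat set \<Rightarrow> nat set"
  where "digit_sums a E = (\<lambda>c. \<Sum>e\<in>E. c e * a ^ e) ` (E \<rightarrow>\<^sub>E {..<a})"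

lemma digit_sum_less:
  fixes c :: "nat \<Rightarrow> nat"
  assumes "\<And>e. e < k \<Longrightarrow> c e < a"
  shows "(\<Sum>e<k. c e * a ^ e) < a ^ k"
  using assms
proof (induction k)
  case (Suc k)
  have "(\<Sum>e<Suc k. c e * a ^ e) < a ^ k + c k * a ^ k"
    using Suc by simp
  also have "\<dots> = (c k + 1) * a ^ k"
    by simp
  also have "\<dots> \<le> a ^ Suc k"
    using Suc.prems[of k] by (simp only: power_Suc) (intro mult_right_mono, auto)
  finally show ?case .
qed simp

text \<open>By \<open>digit_sum_less\<close>, the digits below the top one sum to less than
  \<open>a ^ k\<close>. Hence \<open>mod a ^ k\<close> recovers the lower sum and
  \<open>div a ^ k\<close> the top digit, and induction does the rest.\<close>

lemma digit_sum_inject: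
  fixes c d :: "nat \<Rightarrow> nat"
  assumes "\<And>e. e < k \<Longrightarrow> c e < a" "\<And>e. e < k \<Longrightarrow> d e < a"
    and "(\<Sum>e<k. c e * a ^ e) = (\<Sum>e<k. d e * a ^ e)"
    and "e < k"
  shows "c e = d e"
  using assms
proof (induction k)
  case (Suc k)
  have c: "(\<Sum>e<k. c e * a ^ e) < a ^ k" and d: "(\<Sum>e<k. d e * a ^ e) < a ^ k"
    using Suc.prems by (auto intro: digit_sum_less)
  have eq: "(\<Sum>e<k. c e * a ^ e) + c k * a ^ k = (\<Sum>e<k. d e * a ^ e) + d k * a ^ k"
    using Suc.prems(3) by simp
  have "(\<Sum>e<k. c e * a ^ e) = (\<Sum>e<k. d e * a ^ e)"
    using arg_cong[OF eq, of "\<lambda>x. x mod a ^ k"] c d by simp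
  moreover have "a ^ k \<noteq> 0"
    using c by (intro notI) simp
  then have "c k = d k"
    using arg_cong[OF eq, of "\<lambda>x. x div a ^ k"] c d by simp
  ultimately show ?case
    using Suc by (metis less_Suc_eq)
qed simp

lemma inj_on_digit_sum:
  assumes "finite E" "0 < a"
  shows "inj_on (\<lambda>c. \<Sum>e\<in>E. c e * a ^ e) (E \<rightarrow>\<^sub>E {..<a::nat})"
proof (rule inj_onI)
  fix c d assume c: "c \<in> E \<rightarrow>\<^sub>E {..<a}" and d: "d \<in> E \<rightarrow>\<^sub>E {..<a}"
    and eq: "(\<Sum>e\<in>E. c e * a ^ e) = (\<Sum>e\<in>E. d e * a ^ e)"
  obtain k where k: "E \<subseteq> {..<k}"
    using \<open>finite E\<close> by (metis finite_nat_set_iff_bounded lessThan_iff subsetI)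
  \<comment> \<open>Filling the exponents outside \<open>E\<close> with zero digits reduces the
    claim to an initial segment of exponents.\<close>
  define pad where "pad f = (\<lambda>e. if e \<in> E then f e else (0::nat))" for f :: "nat \<Rightarrow> nat"
  have pad: "(\<Sum>e<k. pad f e * a ^ e) = (\<Sum>e\<in>E. f e * a ^ e)" for f
    using k by (intro sum.mono_neutral_cong_right) (auto simp: pad_def)
  have "pad c e = pad d e" if "e < k" for e
  proof (rule digit_sum_inject[OF _ _ _ that])
    show "pad c e < a" "pad d e < a" for e
      using c d \<open>0 < a\<close> by (auto simp: pad_def PiE_iff)
    show "(\<Sum>e<k. pad c e * a ^ e) = (\<Sum>e<k. pad d e * a ^ e)"
      using eq by (simp add: pad)
  qed
  then have "c e = d e" if "e \<in> E" for e
    using that k unfolding pad_def by (metis lessThan_iff subsetD)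
  then show "c = d"
    using c d by (intro PiE_ext)
qed

lemma finite_digit_sums: "finite E \<Longrightarrow> finite (digit_sums a E)"
  unfolding digit_sums_def by (intro finite_imageI finite_PiE) auto

lemma card_digit_sums:
  assumes "finite E" "0 < a"
  shows "card (digit_sums a E) = a ^ card E"
  using assms by (simp add: digit_sums_def card_image inj_on_digit_sum card_PiE)

text \<open>The inclusion is \<open>digit_sum_less\<close>. Both sets have \<open>a ^ k\<close>
  elements, so no expansion of a given number has to be constructed.\<close>

lemma digit_sums_lessThan:
  assumes "0 < a"
  shows "digit_sums a {..<k} = {..<a ^ k}"
proof (rule card_subset_eq)
  show "digit_sums a {..<k} \<subseteq> {..<a ^ k}"
    by (auto simp: digit_sums_def PiE_iff intro!: digit_sum_less)
  show "card (digit_sums a {..<k}) = card {..<a ^ k}"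
    using assms by (simp add: card_digit_sums)
qed simp

lemma digit_sums_shift: "digit_sums a ((+) p ` E) = (*) (a ^ p) ` digit_sums a E"
proof -
  have "(\<lambda>c. \<Sum>e\<in>(+) p ` E. c e * a ^ e) ` ((+) p ` E \<rightarrow>\<^sub>E {..<a})
      = (\<lambda>c. a ^ p * (\<Sum>e\<in>E. c e * a ^ e)) ` (E \<rightarrow>\<^sub>E {..<a})" (is "?L = ?R")
  proof (intro equalityI subsetI)
    fix x assume "x \<in> ?L"
    then obtain c where c: "c \<in> (+) p ` E \<rightarrow>\<^sub>E {..<a}" and x: "x = (\<Sum>e\<in>(+) p ` E. c e * a ^ e)"
      by auto
    have "x = a ^ p * (\<Sum>e\<in>E. restrict (\<lambda>e. c (p + e)) E e * a ^ e)"
      by (simp add: x sum.reindex sum_distrib_left power_add mult_ac)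
    moreover have "restrict (\<lambda>e. c (p + e)) E \<in> E \<rightarrow>\<^sub>E {..<a}"
      using c by auto
    ultimately show "x \<in> ?R"
      by blast
  next
    fix x assume "x \<in> ?R"
    then obtain c where c: "c \<in> E \<rightarrow>\<^sub>E {..<a}" and x: "x = a ^ p * (\<Sum>e\<in>E. c e * a ^ e)"
      by auto
    have "x = (\<Sum>e\<in>(+) p ` E. restrict (\<lambda>e. c (e - p)) ((+) p ` E) e * a ^ e)"
      by (simp add: x sum.reindex sum_distrib_left power_add mult_ac)
    moreover have "restrict (\<lambda>e. c (e - p)) ((+) p ` E) \<in> (+) p ` E \<rightarrow>\<^sub>E {..<a}"
      using c by auto
    ultimately show "x \<in> ?L"
      by blast
  qed
  then show ?thesis
    by (simp add: digit_sums_def image_image)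
qed

text \<open>Digit functions on disjoint sets can be glued, and those on the union restricted, which
  gives surjectivity. Injectivity follows by counting: \<open>card E + card E'\<close> is the number
  of free digits on both sides.\<close>

lemma bij_betw_digit_sums_Un:
  assumes "finite E" "finite E'" "E \<inter> E' = {}" "0 < a"
  shows "bij_betw (\<lambda>(x, y). x + y) (digit_sums a E \<times> digit_sums a E') (digit_sums a (E \<union> E'))"
proof -
  let ?f = "\<lambda>(x, y). x + y :: nat" and ?S = "digit_sums a E \<times> digit_sums a E'"
  have image: "?f ` ?S = digit_sums a (E \<union> E')"
  proof (intro equalityI subsetI)
    fix z assume "z \<in> ?f ` ?S"
    then obtain c d where c: "c \<in> E \<rightarrow>\<^sub>E {..<a}" and d: "d \<in> E' \<rightarrow>\<^sub>E {..<a}"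
      and z: "z = (\<Sum>e\<in>E. c e * a ^ e) + (\<Sum>e\<in>E'. d e * a ^ e)"
      by (auto simp: digit_sums_def)
    define g where "g = merge E E' (c, d)"
    have "z = (\<Sum>e\<in>E \<union> E'. g e * a ^ e)"
      using assms unfolding z g_def
      by (subst sum.union_disjoint) (auto intro!: arg_cong2[where f = "(+)"] sum.cong simp: merge_def)
    moreover have "g \<in> E \<union> E' \<rightarrow>\<^sub>E {..<a}"
      using c d unfolding g_def merge_def by auto
    ultimately show "z \<in> digit_sums a (E \<union> E')"
      unfolding digit_sums_def by blast
  next
    fix z assume "z \<in> digit_sums a (E \<union> E')"
    then obtain g where g: "g \<in> E \<union> E' \<rightarrow>\<^sub>E {..<a}" and z: "z = (\<Sum>e\<in>E \<union> E'. g e * a ^ e)"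
      by (auto simp: digit_sums_def)
    have "z = (\<Sum>e\<in>E. restrict g E e * a ^ e) + (\<Sum>e\<in>E'. restrict g E' e * a ^ e)"
      using assms unfolding z by (subst sum.union_disjoint) auto
    moreover have "restrict g E \<in> E \<rightarrow>\<^sub>E {..<a}" "restrict g E' \<in> E' \<rightarrow>\<^sub>E {..<a}"
      using g by auto
    ultimately show "z \<in> ?f ` ?S"
      unfolding digit_sums_def by blast
  qed
  have "card (?f ` ?S) = card ?S"
    using assms unfolding image by (simp add: card_digit_sums card_cartesian_product card_Un_disjoint power_add)
  then have "inj_on ?f ?S"
    using assms by (intro eq_card_imp_inj_on) (auto intro: finite_digit_sums)
  with image show ?thesis
    by (simp add: bij_betw_def)
qed

lemma sum_digit_sums_Un:
  fixes g :: "nat \<Rightarrow> 'b::comm_monoid_add"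
  assumes "finite E" "finite E'" "E \<inter> E' = {}" "0 < a"
  shows "(\<Sum>x\<in>digit_sums a E. \<Sum>y\<in>digit_sums a E'. g (x + y)) = sum g (digit_sums a (E \<union> E'))"
  using sum.reindex_bij_betw[OF bij_betw_digit_sums_Un[OF assms], of g]
  by (simp add: sum.cartesian_product case_prod_unfold)

section \<open>The digit exponents of \<open>B\<close> and \<open>F\<close>\<close>

text \<open>Stated with \<open><=\<close> to cover at once the exponents of \<open>B\<close>
  (equality) and of \<open>F\<close> (strict inequality). Each residue modulo \<open>p\<close>
  contributes finitely many exponents.\<close>

lemma finite_exponents:
  fixes n :: "nat \<Rightarrow> nat"
  assumes "0 < p"
  shows "finite {e. e div p \<le> n (e mod p)}"
proof (rule finite_subset)
  show "{e. e div p \<le> n (e mod p)} \<subseteq> (\<Union>i<p. (\<lambda>m. m * p + i) ` {..n i})"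
  proof
    fix e assume "e \<in> {e. e div p \<le> n (e mod p)}"
    then have "e div p \<in> {..n (e mod p)}" "e mod p \<in> {..<p}" "e = e div p * p + e mod p"
      using \<open>0 < p\<close> by auto
    then show "e \<in> (\<Union>i<p. (\<lambda>m. m * p + i) ` {..n i})"
      by blast
  qed
qed simp

text \<open>The identity between \<open>B\<close>, \<open>F\<close> and
  \<open>{0, ..., A - 1}\<close>, phrased as an equality of sums for arbitrary \<open>g\<close>.
  Both sides sum \<open>g\<close> over the numbers with digits at the exponents
  \<open>e div p <= n (e mod p)\<close>.\<close>

lemma sum_digit_sums_exchange:
  fixes n :: "nat \<Rightarrow> nat" and g :: "nat \<Rightarrow> 'b::comm_monoid_add"
  assumes "0 < a" "0 < p"
  shows "(\<Sum>b\<in>digit_sums a {e. e div p = n (e mod p)}. \<Sum>y\<in>digit_sums a {e. e div p < n (e mod p)}. g (y + b))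
    = (\<Sum>y\<in>digit_sums a {e. e div p < n (e mod p)}. \<Sum>d<a ^ p. g (a ^ p * y + d))"
  (is "(\<Sum>b\<in>digit_sums a ?EB. \<Sum>y\<in>digit_sums a ?EF. g (y + b)) = ?rhs")
proof -
  have finF: "finite ?EF" and finB: "finite ?EB"
    by (auto intro: finite_subset[OF _ finite_exponents[OF \<open>0 < p\<close>, of n]])
  \<comment> \<open>Adding \<open>p\<close> keeps the residue and raises the quotient by 1, so
    \<open><\<close> turns into \<open><=\<close> for the exponents from \<open>p\<close> on.
    Exponents below \<open>p\<close> have quotient 0 and always satisfy \<open><=\<close>.\<close>
  have split: "{..<p} \<union> (+) p ` ?EF = ?EF \<union> ?EB"
  proof (intro set_eqI)
    fix e
    show "e \<in> {..<p} \<union> (+) p ` ?EF \<longleftrightarrow> e \<in> ?EF \<union> ?EB"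
    proof (cases "e < p")
      case False
      define k where "k = e - p"
      then have e: "e = p + k"
        using False by simp
      show ?thesis
        using \<open>0 < p\<close> by (auto simp: e)
    qed auto
  qed
  have "(\<Sum>b\<in>digit_sums a ?EB. \<Sum>y\<in>digit_sums a ?EF. g (y + b)) =
      sum g (digit_sums a ({..<p} \<union> (+) p ` ?EF))"
    unfolding split
    by (subst sum.swap, subst sum_digit_sums_Un) (use finF finB assms in auto)
  also have "\<dots> = (\<Sum>d<a ^ p. \<Sum>y\<in>(*) (a ^ p) ` digit_sums a ?EF. g (d + y))"
    using finF assms
    by (subst sum_digit_sums_Un[symmetric]) (auto simp: digit_sums_lessThan digit_sums_shift)
  also have "\<dots> = (\<Sum>d<a ^ p. \<Sum>y\<in>digit_sums a ?EF. g (a ^ p * y + d))"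
    using assms by (simp add: sum.reindex inj_on_def add.commute)
  finally show ?thesis
    by (subst (asm) (2) sum.swap)
qed

text \<open>The exponent \<open>n i * p + i\<close> is the only one in the set with residue
  \<open>i\<close>, so choosing an element of the \<open>i\<close>-th summand amounts to choosing
  the digit there.\<close>

lemma direct_sum_eq_digit_sums:
  fixes n :: "nat \<Rightarrow> nat"
  assumes "0 < p"
    and "is_direct_sum {..<p} (\<lambda>i. (\<lambda>c. real a ^ (n i * p + i) * c) ` real ` {..<a}) B"
  shows "B = real ` digit_sums a {e. e div p = n (e mod p)}" (is "_ = real ` digit_sums a ?E")
proof -
  define f where "f i = n i * p + i" for i
  have E: "?E = f ` {..<p}"
  proof (intro equalityI subsetI)
    fix e assume "e \<in> ?E"
    then have "e = f (e mod p)" "e mod p \<in> {..<p}"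
      using \<open>0 < p\<close> div_mult_mod_eq[of e p] by (simp_all add: f_def)
    then show "e \<in> f ` {..<p}" by blast
  qed (auto simp: f_def)
  have modf: "f i mod p = i" if "i < p" for i
    using that by (simp add: f_def)
  then have inj: "inj_on f {..<p}"
    by (intro inj_on_inverseI[where g = "\<lambda>e. e mod p"]) simp
  have "B = {\<Sum>i<p. x i |x. x \<in> Pi\<^sub>E {..<p} (\<lambda>i. (\<lambda>c. real a ^ f i * c) ` real ` {..<a})}"
    using assms(2) by (simp add: is_direct_sum_def f_def)
  also have "\<dots> = real ` digit_sums a ?E" (is "?L = ?R")
  proof (intro equalityI subsetI)
    fix r assume "r \<in> ?L"
    then obtain x where x: "x \<in> Pi\<^sub>E {..<p} (\<lambda>i. (\<lambda>c. real a ^ f i * c) ` real ` {..<a})"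
      and r: "r = (\<Sum>i<p. x i)" by auto
    have "\<forall>i\<in>{..<p}. \<exists>c<a. x i = real a ^ f i * real c"
      using x by (auto simp: PiE_iff)
    then obtain c where c: "c i < a" "x i = real a ^ f i * real (c i)" if "i < p" for i
      by (metis lessThan_iff)
    have "r = real (\<Sum>e\<in>?E. restrict (\<lambda>e. c (e mod p)) ?E e * a ^ e)"
      unfolding E r using inj by (simp add: sum.reindex c modf mult.commute)
    moreover have "restrict (\<lambda>e. c (e mod p)) ?E \<in> ?E \<rightarrow>\<^sub>E {..<a}"
      using c \<open>0 < p\<close> by auto
    ultimately show "r \<in> ?R"
      unfolding digit_sums_def by blast
  next
    fix r assume "r \<in> ?R"
    then obtain c where c: "c \<in> ?E \<rightarrow>\<^sub>E {..<a}" and r: "r = real (\<Sum>e\<in>?E. c e * a ^ e)"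
      by (auto simp: digit_sums_def)
    define x where "x = restrict (\<lambda>i. real a ^ f i * real (c (f i))) {..<p}"
    have "r = (\<Sum>i<p. x i)"
      unfolding r E x_def using inj by (simp add: sum.reindex mult.commute)
    moreover have "x \<in> Pi\<^sub>E {..<p} (\<lambda>i. (\<lambda>c. real a ^ f i * c) ` real ` {..<a})"
      using c unfolding E x_def by auto
    ultimately show "r \<in> ?L" by blast
  qed
  finally show ?thesis .
qed

section \<open>Uniqueness of the invariant measure\<close>

text \<open>Needed for \<open>cos\<close> and \<open>sin\<close>, which do not have compact support.
  Invariance is applied to \<open>f\<close> times a cutoff, and dominated convergence removes the
  cutoff.\<close>

lemma is_invariant_measure_bounded:
  fixes f :: "real \<Rightarrow> real"
  assumes inv: "is_invariant_measure A B \<mu>"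
    and f: "continuous_on UNIV f" and bound: "\<And>x. \<bar>f x\<bar> \<le> K"
  shows "(\<integral>x. f x \<partial>\<mu>) = 1 / real (card B) * (\<Sum>b\<in>B. \<integral>x. f (ifs_map A b x) \<partial>\<mu>)"
proof -
  interpret prob_space \<mu>
    using inv by (simp add: is_invariant_measure_def)
  have [measurable_cong]: "sets \<mu> = sets borel"
    using inv by (simp add: is_invariant_measure_def)
  have [measurable]: "f \<in> borel_measurable borel"
    using f by (rule borel_measurable_continuous_onI)
  \<comment> \<open>A continuous trapezoid: 1 on \<open>[-k, k]\<close>, 0 outside
    \<open>[-(k+1), k+1]\<close>.\<close>
  define cut where "cut k x = max 0 (min 1 (real k + 1 - \<bar>x\<bar>))" for k and x :: real
  have [measurable]: "cut k \<in> borel_measurable borel" for k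
    unfolding cut_def by measurable
  have cut_bound: "\<bar>f x * cut k x\<bar> \<le> K" for k x
  proof -
    have "\<bar>f x * cut k x\<bar> \<le> \<bar>f x\<bar> * 1"
      unfolding abs_mult by (intro mult_left_mono) (auto simp: cut_def)
    with bound[of x] show ?thesis by simp
  qed
  have cut_lim: "(\<lambda>k. f x * cut k x) \<longlonglongrightarrow> f x" for x
  proof (rule tendsto_eventually)
    have "f x * cut k x = f x" if "k \<ge> nat \<lceil>\<bar>x\<bar>\<rceil>" for k
    proof -
      have "\<bar>x\<bar> \<le> real k" using that by linarith
      then show ?thesis by (simp add: cut_def)
    qed
    then show "\<forall>\<^sub>F k in sequentially. f x * cut k x = f x"
      unfolding eventually_sequentially by blast
  qed
  \<comment> \<open>The map \<open>\<tau>\<close> is arbitrary in order to serve both sides of the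
    invariance: the identity on the left, the maps \<open>ifs_map A b\<close> on the right.\<close>
  have lim: "(\<lambda>k. \<integral>x. f (\<tau> x) * cut k (\<tau> x) \<partial>\<mu>) \<longlonglongrightarrow> (\<integral>x. f (\<tau> x) \<partial>\<mu>)"
    if [measurable]: "\<tau> \<in> borel_measurable borel" for \<tau>
    by (rule integral_dominated_convergence[where w = "\<lambda>_. K"]) (auto simp: cut_lim cut_bound)
  have [measurable]: "ifs_map A b \<in> borel_measurable borel" for b
    unfolding ifs_map_def by measurable
  have "(\<lambda>k. \<integral>x. f x * cut k x \<partial>\<mu>) \<longlonglongrightarrow> (\<integral>x. f x \<partial>\<mu>)"
    using lim[of "\<lambda>x. x"] by simp
  moreover have "(\<lambda>k. 1 / real (card B) * (\<Sum>b\<in>B. \<integral>x. f (ifs_map A b x) * cut k (ifs_map A b x) \<partial>\<mu>))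
      \<longlonglongrightarrow> 1 / real (card B) * (\<Sum>b\<in>B. \<integral>x. f (ifs_map A b x) \<partial>\<mu>)"
    by (intro tendsto_mult_left tendsto_sum lim) auto
  moreover have "(\<integral>x. f x * cut k x \<partial>\<mu>)
      = 1 / real (card B) * (\<Sum>b\<in>B. \<integral>x. f (ifs_map A b x) * cut k (ifs_map A b x) \<partial>\<mu>)" for k
  proof -
    have "continuous_on UNIV (\<lambda>x. f x * cut k x)"
      unfolding cut_def by (intro continuous_intros f)
    moreover have "compact (closure {x. f x * cut k x \<noteq> 0})"
    proof -
      have "bounded {x. f x * cut k x \<noteq> 0}"
        by (rule bounded_subset[of "cball 0 (real k + 1)"]) (auto simp: cut_def)
      then show ?thesis by simp
    qed
    ultimately show ?thesis
      using inv unfolding is_invariant_measure_def comp_def by blast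
  qed
  ultimately show ?thesis
    using LIMSEQ_unique by simp
qed

text \<open>Test functions are real-valued, so real and imaginary parts are treated separately.
  Since the maps are affine, \<open>iexp (t * ifs_map A b x)\<close> splits into a factor depending
  on \<open>b\<close> and a factor depending on \<open>x\<close>.\<close>

lemma char_is_invariant_measure:
  assumes inv: "is_invariant_measure A B \<mu>"
  shows "char \<mu> t =
    1 / of_nat (card B) * (\<Sum>b\<in>B. iexp (t / of_int A * b)) * char \<mu> (t / of_int A)"
proof -
  interpret prob_space \<mu>
    using inv by (simp add: is_invariant_measure_def)
  have [measurable_cong]: "sets \<mu> = sets borel"
    using inv by (simp add: is_invariant_measure_def)
  have int: "integrable \<mu> (\<lambda>x. iexp (t * ifs_map A b x))" for b
    unfolding ifs_map_def by (intro integrable_iexp) auto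
  have int': "integrable \<mu> (\<lambda>x. iexp (t * x))"
    by (intro integrable_iexp) auto
  have "char \<mu> t = 1 / of_nat (card B) * (\<Sum>b\<in>B. CLINT x|\<mu>. iexp (t * ifs_map A b x))"
  proof (rule complex_eqI)
    have "Re (char \<mu> t) = (\<integral>x. cos (t * x) \<partial>\<mu>)"
      using int' unfolding char_def by (subst integral_Re[symmetric]) (auto simp: Re_exp)
    also have "\<dots> = 1 / real (card B) * (\<Sum>b\<in>B. \<integral>x. cos (t * ifs_map A b x) \<partial>\<mu>)"
      by (rule is_invariant_measure_bounded[OF inv, where K = 1]) (auto intro!: continuous_intros)
    also have "\<dots> = 1 / real (card B) * (\<Sum>b\<in>B. Re (CLINT x|\<mu>. iexp (t * ifs_map A b x)))"
      using int by (subst integral_Re[symmetric]) (auto simp: Re_exp)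
    finally show "Re (char \<mu> t) = Re (1 / of_nat (card B) * (\<Sum>b\<in>B. CLINT x|\<mu>. iexp (t * ifs_map A b x)))"
      by (simp add: Re_divide_of_nat)
    have "Im (char \<mu> t) = (\<integral>x. sin (t * x) \<partial>\<mu>)"
      using int' unfolding char_def by (subst integral_Im[symmetric]) (auto simp: Im_exp)
    also have "\<dots> = 1 / real (card B) * (\<Sum>b\<in>B. \<integral>x. sin (t * ifs_map A b x) \<partial>\<mu>)"
      by (rule is_invariant_measure_bounded[OF inv, where K = 1]) (auto intro!: continuous_intros)
    also have "\<dots> = 1 / real (card B) * (\<Sum>b\<in>B. Im (CLINT x|\<mu>. iexp (t * ifs_map A b x)))"
      using int by (subst integral_Im[symmetric]) (auto simp: Im_exp)
    finally show "Im (char \<mu> t) = Im (1 / of_nat (card B) * (\<Sum>b\<in>B. CLINT x|\<mu>. iexp (t * ifs_map A b x)))"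
      by (simp add: Im_divide_of_nat)
  qed
  also have "(\<lambda>b. CLINT x|\<mu>. iexp (t * ifs_map A b x)) =
      (\<lambda>b. iexp (t / of_int A * b) * char \<mu> (t / of_int A))"
  proof -
    have "iexp (t * ifs_map A b x) = iexp (t / of_int A * b) * iexp (t / of_int A * x)" for b x
      by (simp add: ifs_map_def exp_add[symmetric] divide_inverse algebra_simps)
    then show ?thesis
      by (simp add: char_def)
  qed
  finally show ?thesis
    by (simp add: sum_distrib_right)
qed

text \<open>The multiplier in the functional equation is a mean of unit complex numbers, so the
  difference \<open>h\<close> of the two characteristic functions does not decrease in norm when
  \<open>t\<close> is replaced by \<open>t / A\<close>. Along \<open>t / A ^ k\<close> it tends to
  \<open>h 0 = 0\<close>, and Levy's uniqueness theorem concludes.\<close>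

lemma is_invariant_measure_unique:
  assumes "A \<ge> 2" "finite B" "B \<noteq> {}"
    and \<mu>: "is_invariant_measure A B \<mu>" and \<nu>: "is_invariant_measure A B \<nu>"
  shows "\<mu> = \<nu>"
proof -
  interpret \<mu>: real_distribution \<mu>
    using \<mu> by (simp add: is_invariant_measure_def real_distribution_def real_distribution_axioms_def)
  interpret \<nu>: real_distribution \<nu>
    using \<nu> by (simp add: is_invariant_measure_def real_distribution_def real_distribution_axioms_def)
  define h where "h t = char \<mu> t - char \<nu> t" for t
  have step: "norm (h t) \<le> norm (h (t / of_int A))" for t
  proof -
    let ?m = "1 / of_nat (card B) * (\<Sum>b\<in>B. iexp (t / of_int A * b))"
    have "norm (\<Sum>b\<in>B. iexp (t / of_int A * b)) \<le> (\<Sum>b\<in>B. 1)"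
      by (rule sum_norm_le) simp
    then have "norm ?m \<le> 1"
      using assms by (simp add: norm_mult norm_divide divide_simps card_gt_0_iff)
    moreover have "h t = ?m * h (t / of_int A)"
      unfolding h_def
      by (simp only: char_is_invariant_measure[OF \<mu>, of t] char_is_invariant_measure[OF \<nu>, of t]
          right_diff_distrib)
    ultimately show ?thesis
      by (simp only: norm_mult) (intro mult_left_le_one_le, auto)
  qed
  have iter: "norm (h t) \<le> norm (h (t / of_int A ^ k))" for t k
  proof (induction k)
    case (Suc k)
    then show ?case
      using step[of "t / of_int A ^ k"] by (simp add: mult.commute)
  qed simp
  have "h t = 0" for t
  proof -
    have "(\<lambda>k. t * inverse (of_int A) ^ k) \<longlonglongrightarrow> t * 0"
      using \<open>A \<ge> 2\<close> by (intro tendsto_mult_left LIMSEQ_power_zero) (simp add: inverse_less_1_iff)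
    then have "(\<lambda>k. t / of_int A ^ k) \<longlonglongrightarrow> 0"
      by (simp add: divide_inverse power_inverse)
    moreover have "isCont h 0"
      unfolding h_def by (intro continuous_intros \<mu>.isCont_char \<nu>.isCont_char)
    ultimately have "(\<lambda>k. h (t / of_int A ^ k)) \<longlonglongrightarrow> h 0"
      by (rule isCont_tendsto_compose[rotated])
    then have "(\<lambda>k. norm (h (t / of_int A ^ k))) \<longlonglongrightarrow> 0"
      using tendsto_norm by (fastforce simp: h_def \<mu>.char_zero \<nu>.char_zero)
    then have "norm (h t) \<le> 0"
      using iter by (intro LIMSEQ_le_const) auto
    then show ?thesis by simp
  qed
  then have "char \<mu> = char \<nu>"
    by (auto simp: h_def fun_eq_iff)
  then show ?thesis
    using Levy_uniqueness \<mu>.real_distribution_axioms \<nu>.real_distribution_axioms by blast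
qed

section \<open>Integrals against \<open>uniform_dirac\<close>, \<open>lebesgue_01\<close> and
  convolutions\<close>

text \<open>Transfers total mass and integrals from the uniform distribution on
  \<open>F\<close>.\<close>

lemma uniform_dirac_eq_distr:
  assumes "finite F" "F \<noteq> {}"
  shows "uniform_dirac F = distr (measure_pmf (pmf_of_set F)) borel (\<lambda>x. x)"
proof (rule measure_eqI)
  fix X assume "X \<in> sets (uniform_dirac F)"
  then have X: "X \<in> sets borel" by simp
  have "emeasure (uniform_dirac F) X = 1 / of_nat (card F) * of_nat (card (F \<inter> X))"
    using assms X by (simp add: emeasure_uniform_dirac indicator_def sum.If_cases Int_def)
  also have "\<dots> = emeasure (measure_pmf (pmf_of_set F)) X"
    using assms by (simp add: emeasure_pmf_of_set divide_ennreal[symmetric] card_gt_0_iff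
        ennreal_of_nat_eq_real_of_nat ennreal_times_divide mult.commute)
  finally show "emeasure (uniform_dirac F) X = emeasure (distr (measure_pmf (pmf_of_set F)) borel (\<lambda>x. x)) X"
    using X by (simp add: emeasure_distr)
qed simp

lemma prob_space_uniform_dirac: "finite F \<Longrightarrow> F \<noteq> {} \<Longrightarrow> prob_space (uniform_dirac F)"
  by (simp add: uniform_dirac_eq_distr measure_pmf.prob_space_distr)

lemma integral_uniform_dirac:
  fixes f :: "real \<Rightarrow> real"
  assumes "finite F" "F \<noteq> {}" "f \<in> borel_measurable borel"
  shows "(\<integral>x. f x \<partial>uniform_dirac F) = sum f F / card F"
  using assms by (simp add: uniform_dirac_eq_distr integral_distr integral_pmf_of_set)

text \<open>The endpoint 1 is a null set. Half-open intervals have disjoint integer translates,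
  which makes the subdivision below exact.\<close>

lemma lebesgue_01_eq: "lebesgue_01 = density lborel (indicator {0..<1})"
  unfolding lebesgue_01_def
proof (rule density_cong)
  show "AE x in lborel. (indicator {0..1} x :: ennreal) = indicator {0..<1} (x::real)"
    using AE_lborel_singleton[of "1::real"] by eventually_elim (auto simp: indicator_def)
qed auto

lemma sets_lebesgue_01 [simp]: "sets lebesgue_01 = sets borel"
  by (simp add: lebesgue_01_def)

lemma prob_space_lebesgue_01: "prob_space lebesgue_01"
  by (rule prob_spaceI) (simp add: lebesgue_01_def emeasure_density)

lemma integral_lebesgue_01:
  fixes f :: "real \<Rightarrow> real"
  assumes "f \<in> borel_measurable borel"
  shows "(\<integral>x. f x \<partial>lebesgue_01) = (\<integral>x. indicator {0..<1} x * f x \<partial>lborel)"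
proof -
  have eq: "lebesgue_01 = density lborel (\<lambda>x. ennreal (indicator {0..<1} x))"
    by (simp add: lebesgue_01_eq ennreal_indicator)
  show ?thesis
    unfolding eq using assms by (subst integral_density) auto
qed

text \<open>The maps \<open>u \<mapsto> (u + d) / N\<close> send \<open>[0,1)\<close> onto the
  \<open>N\<close> cells \<open>[d/N, (d+1)/N)\<close>, which tile \<open>[0,1)\<close>. This is the
  invariance of Lebesgue measure for the digits \<open>0, ..., N - 1\<close>.\<close>

lemma integral_lebesgue_01_subdivide:
  fixes f :: "real \<Rightarrow> real"
  assumes [measurable]: "f \<in> borel_measurable borel" and bound: "\<And>x. \<bar>f x\<bar> \<le> K" and "0 < N"
  shows "(\<Sum>d<N. \<integral>u. f ((u + real d) / real N) \<partial>lebesgue_01) = real N * (\<integral>u. f u \<partial>lebesgue_01)"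
proof -
  have split: "(\<Sum>d<M. indicator {0..<1} (x - real d)) = (indicator {0..<real M} x :: real)"
    for M and x :: real
    by (induction M) (auto simp: indicator_def)
  have int: "integrable lborel (\<lambda>v. indicator {0..<1} (real N * v - real d) * f v)" for d
  proof (rule Bochner_Integration.integrable_bound)
    show "integrable lborel (\<lambda>v. K * indicator {real d / real N..(real d + 1) / real N} v)"
      using \<open>0 < N\<close>
      by (intro integrable_mult_right integrable_real_indicator) (auto simp: divide_right_mono)
    show "AE v in lborel. norm (indicator {0..<1} (real N * v - real d) * f v)
        \<le> norm (K * indicator {real d / real N..(real d + 1) / real N} v)"
      using \<open>0 < N\<close> bound by (intro AE_I2) (auto simp: indicator_def field_simps intro: order_trans[OF _ abs_ge_self])
  qed measurable
  \<comment> \<open>Change of variables \<open>v = (u + d) / N\<close>, with Jacobian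
    \<open>1 / N\<close>.\<close>
  have piece: "(\<integral>v. indicator {0..<1} (real N * v - real d) * f v \<partial>lborel)
      = (\<integral>u. f ((u + real d) / real N) \<partial>lebesgue_01) / real N" for d
  proof -
    have "real N * (real d / real N + 1 / real N * u) - real d = u"
      "real d / real N + 1 / real N * u = (u + real d) / real N" for u
      using \<open>0 < N\<close> by (simp_all add: field_simps)
    then show ?thesis
      using \<open>0 < N\<close>
      by (subst lborel_integral_real_affine[where c = "1 / real N" and t = "real d / real N"])
         (simp_all, subst integral_lebesgue_01, measurable)
  qed
  have "(\<integral>u. f u \<partial>lebesgue_01) =
      (\<integral>v. (\<Sum>d<N. indicator {0..<1} (real N * v - real d) * f v) \<partial>lborel)"
    unfolding integral_lebesgue_01[OF assms(1)] sum_distrib_right[symmetric] split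
    using \<open>0 < N\<close> by (intro Bochner_Integration.integral_cong) (auto simp: indicator_def zero_le_mult_iff)
  also have "\<dots> = (\<Sum>d<N. \<integral>v. indicator {0..<1} (real N * v - real d) * f v \<partial>lborel)"
    using int by (rule Bochner_Integration.integral_sum)
  also have "\<dots> = (\<Sum>d<N. (\<integral>u. f ((u + real d) / real N) \<partial>lebesgue_01) / real N)"
    by (simp only: piece)
  finally show ?thesis
    using \<open>0 < N\<close> by (simp add: sum_divide_distrib[symmetric])
qed

text \<open>Fubini, with integrability from boundedness on a probability space. The second factor is
  outermost, so that integrating over \<open>uniform_dirac F\<close> leaves a finite sum.\<close>

lemma integral_convolution_bounded:
  fixes f :: "real \<Rightarrow> real"
  assumes "prob_space M" "prob_space N"
    and [measurable_cong]: "sets M = sets borel" "sets N = sets borel"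
    and [measurable]: "f \<in> borel_measurable borel" and bound: "\<And>x. \<bar>f x\<bar> \<le> K"
  shows "(\<integral>x. f x \<partial>(M \<star> N)) = (\<integral>x. \<integral>y. f (x + y) \<partial>M \<partial>N)"
proof -
  interpret M: prob_space M by fact
  interpret N: prob_space N by fact
  interpret pair_prob_space M N ..
  have "(\<integral>x. f x \<partial>(M \<star> N)) = (\<integral>z. (case z of (x, y) \<Rightarrow> f (x + y)) \<partial>(M \<Otimes>\<^sub>M N))"
    unfolding convolution_def by (subst integral_distr) (auto simp: case_prod_unfold)
  also have "\<dots> = (\<integral>y. \<integral>x. f (x + y) \<partial>M \<partial>N)"
    by (rule integral_snd[symmetric], rule integrable_const_bound[where B = K])
       (auto simp: bound)
  finally show ?thesis
    by (simp add: add.commute)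
qed

lemma prob_space_convolution:
  fixes M N :: "real measure"
  assumes "prob_space M" "prob_space N" and [measurable_cong]: "sets M = sets borel" "sets N = sets borel"
  shows "prob_space (M \<star> N)"
proof -
  interpret M: prob_space M by fact
  interpret N: prob_space N by fact
  interpret pair_prob_space M N ..
  show ?thesis
    unfolding convolution_def by (rule prob_space_distr) measurable
qed

section \<open>Invariance of the convolution and identification of the measure\<close>

text \<open>Composing with the map for \<open>b\<close> and translating by \<open>y\<close> in
  \<open>F\<close> gives a cell integral that depends only on \<open>y + b\<close>. The exchange
  identity regroups these cells into full unit intervals starting at the points of
  \<open>F\<close>.\<close>

lemma is_invariant_measure_convolution:
  fixes n :: "nat \<Rightarrow> nat"
  assumes "0 < a" "0 < p"
    and F: "F = real ` digit_sums a {e. e div p < n (e mod p)}"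
    and B: "B = real ` digit_sums a {e. e div p = n (e mod p)}"
  shows "is_invariant_measure (int a ^ p) B (lebesgue_01 \<star> uniform_dirac F)"
proof -
  let ?F = "digit_sums a {e. e div p < n (e mod p)}" and ?B = "digit_sums a {e. e div p = n (e mod p)}"
  let ?\<nu> = "lebesgue_01 \<star> uniform_dirac F"
  have fin: "finite {e. e div p < n (e mod p)}"
    by (rule finite_subset[OF _ finite_exponents[OF \<open>0 < p\<close>, of n]]) auto
  have cardF: "card ?F > 0"
    using \<open>0 < a\<close> fin by (simp add: card_digit_sums)
  have finF: "finite F" "F \<noteq> {}"
    using cardF by (auto simp: F card_gt_0_iff)
  \<comment> \<open>The exchange identity with constant \<open>g = 1\<close> counts pairs.
    Cancelling the positive \<open>card ?F\<close> gives the normalisation.\<close>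
  have "card ?B * card ?F = card ?F * a ^ p"
    using sum_digit_sums_exchange[OF assms(1,2), where n = n and g = "\<lambda>_. 1 :: nat"] by simp
  then have cardB: "card B = a ^ p"
    using cardF by (simp add: B card_image)
  have integral: "(\<integral>x. f x \<partial>?\<nu>) = (\<Sum>y\<in>?F. \<integral>u. f (u + real y) \<partial>lebesgue_01) / card F"
    if [measurable]: "f \<in> borel_measurable borel" and bound: "\<And>x. \<bar>f x\<bar> \<le> K" for f K
  proof -
    interpret L: prob_space lebesgue_01
      by (rule prob_space_lebesgue_01)
    have [measurable_cong]: "sets lebesgue_01 = sets borel"
      by simp
    have "(\<integral>x. f x \<partial>?\<nu>) = (\<integral>y. \<integral>u. f (y + u) \<partial>lebesgue_01 \<partial>uniform_dirac F)"
      using finF bound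
      by (intro integral_convolution_bounded) (auto intro: prob_space_lebesgue_01 prob_space_uniform_dirac)
    also have "\<dots> = (\<Sum>y\<in>F. \<integral>u. f (y + u) \<partial>lebesgue_01) / card F"
      using finF by (rule integral_uniform_dirac) measurable
    finally show ?thesis
      by (simp add: F sum.reindex add.commute)
  qed
  show ?thesis
    unfolding is_invariant_measure_def
  proof (intro conjI allI impI)
    show "prob_space ?\<nu>"
      using finF by (intro prob_space_convolution prob_space_lebesgue_01 prob_space_uniform_dirac) auto
  next
    fix f :: "real \<Rightarrow> real"
    assume f: "continuous_on UNIV f \<and> compact (closure {x. f x \<noteq> 0})"
    then have [measurable]: "f \<in> borel_measurable borel"
      by (intro borel_measurable_continuous_onI) simp
    have "bounded (f ` closure {x. f x \<noteq> 0})"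
      using f by (intro compact_imp_bounded compact_continuous_image) (auto intro: continuous_on_subset)
    then obtain K where K: "\<And>x. x \<in> closure {x. f x \<noteq> 0} \<Longrightarrow> \<bar>f x\<bar> \<le> K"
      by (auto simp: bounded_iff)
    \<comment> \<open>\<open>K\<close> is a bound on the closed support only and may be negative
      when that is empty; its absolute value also covers the zeros of \<open>f\<close>.\<close>
    have bound: "\<bar>f x\<bar> \<le> \<bar>K\<bar>" for x
    proof (cases "f x = 0")
      case False
      then have "x \<in> closure {x. f x \<noteq> 0}"
        by (intro closure_subset[THEN subsetD]) simp
      from K[OF this] show ?thesis by simp
    qed simp
    let ?N = "a ^ p"
    \<comment> \<open>The mean of \<open>f\<close> over the cell \<open>[m/N, (m+1)/N]\<close>,
      where \<open>N = a ^ p\<close>.\<close>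
    define J where "J m = (\<integral>u. f ((u + real m) / real ?N) \<partial>lebesgue_01)" for m :: nat
    have "(\<Sum>b\<in>B. \<integral>x. (f \<circ> ifs_map (int a ^ p) b) x \<partial>?\<nu>)
        = (\<Sum>b\<in>?B. \<integral>x. f ((x + real b) / real ?N) \<partial>?\<nu>)"
      by (simp add: B sum.reindex ifs_map_def divide_inverse mult.commute)
    also have "\<dots> = (\<Sum>b\<in>?B. \<Sum>y\<in>?F. J (y + b)) / card F"
    proof -
      have "(\<integral>x. f ((x + real b) / real ?N) \<partial>?\<nu>) = (\<Sum>y\<in>?F. J (y + b)) / card F" for b
        using bound by (subst integral[where K = "\<bar>K\<bar>"]) (simp_all add: J_def add.assoc)
      then show ?thesis
        by (simp add: sum_divide_distrib)
    qed
    also have "(\<Sum>b\<in>?B. \<Sum>y\<in>?F. J (y + b)) = (\<Sum>y\<in>?F. \<Sum>d<?N. J (?N * y + d))"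
      by (rule sum_digit_sums_exchange[OF assms(1,2)])
    also have "\<dots> = (\<Sum>y\<in>?F. real ?N * (\<integral>u. f (u + real y) \<partial>lebesgue_01))"
    proof (rule sum.cong[OF refl])
      fix y
      \<comment> \<open>The multiple of \<open>N\<close> leaves the quotient as the translation by
        \<open>y\<close>, so for fixed \<open>y\<close> the cells subdivide
        \<open>[y, y+1]\<close>.\<close>
      have "(u + real (?N * y + d)) / real ?N = (u + real d) / real ?N + real y" for u d
        using \<open>0 < a\<close> by (simp add: field_simps)
      then have "(\<Sum>d<?N. J (?N * y + d))
          = (\<Sum>d<?N. \<integral>u. f ((u + real d) / real ?N + real y) \<partial>lebesgue_01)"
        by (simp only: J_def)
      also have "\<dots> = real ?N * (\<integral>u. f (u + real y) \<partial>lebesgue_01)"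
        using \<open>0 < a\<close> bound
        by (intro integral_lebesgue_01_subdivide[where f = "\<lambda>u. f (u + real y)"]) auto
      finally show "(\<Sum>d<?N. J (?N * y + d)) = real ?N * (\<integral>u. f (u + real y) \<partial>lebesgue_01)" .
    qed
    also have "\<dots> / card F = real ?N * (\<integral>x. f x \<partial>?\<nu>)"
      using bound by (subst integral[where K = "\<bar>K\<bar>"]) (simp_all add: sum_distrib_left)
    finally show "(\<integral>x. f x \<partial>?\<nu>) =
        1 / real (card B) * (\<Sum>b\<in>B. \<integral>x. (f \<circ> ifs_map (int a ^ p) b) x \<partial>?\<nu>)"
      using \<open>0 < a\<close> by (simp add: cardB)
  qed simp
qed

theorem corollary3p19:
  fixes A a :: int and p :: nat and n :: "nat \<Rightarrow> nat" and B C :: "real set"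
  assumes "A \<ge> 2" and "a \<ge> 2" and "p \<ge> 2" and "A = a ^ p"
    and "C = real_of_int ` {0..a - 1}"
    and "is_direct_sum {..<p} (\<lambda>i. (\<lambda>c. real_of_int a ^ (n i * p + i) * c) ` C) B"
  shows "\<exists>F :: real set. finite F \<and> F \<noteq> {} \<and> F \<subseteq> \<int> \<and>
           invariant_measure A B = (lebesgue_01 \<star> uniform_dirac F)"
proof -
  \<comment> \<open>The digit lemmas work over the naturals, hence the passage from the integer
    \<open>a\<close> to \<open>k\<close>.\<close>
  define k where "k = nat a"
  have a: "a = int k" and "0 < k" "0 < p"
    using assms(2,3) by (auto simp: k_def)
  have "(of_int ` {0..a - 1} :: real set) = real ` {..<k}"
  proof -
    have "{0..a - 1} = int ` {..<k}"
      by (simp only: a lessThan_atLeast0 image_int_atLeastLessThan) auto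
    then show ?thesis
      by (simp add: image_image)
  qed
  with assms(5,6) have "is_direct_sum {..<p} (\<lambda>i. (\<lambda>c. real k ^ (n i * p + i) * c) ` real ` {..<k}) B"
    by (simp add: a)
  then have B: "B = real ` digit_sums k {e. e div p = n (e mod p)}"
    by (rule direct_sum_eq_digit_sums[OF \<open>0 < p\<close>])
  define F where "F = real ` digit_sums k {e. e div p < n (e mod p)}"
  have fin: "finite {e. e div p < n (e mod p)}" "finite {e. e div p = n (e mod p)}"
    by (auto intro: finite_subset[OF _ finite_exponents[OF \<open>0 < p\<close>, of n]])
  have nonempty: "digit_sums k E \<noteq> {}" for E
    using \<open>0 < k\<close> by (auto simp: digit_sums_def PiE_eq_empty_iff)
  have inv: "is_invariant_measure A B (lebesgue_01 \<star> uniform_dirac F)"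
    using is_invariant_measure_convolution[OF \<open>0 < k\<close> \<open>0 < p\<close> F_def B] assms(4) by (simp add: a)
  \<comment> \<open>A definite description: invariance supplies existence, the characteristic
    function argument uniqueness.\<close>
  have "invariant_measure A B = (lebesgue_01 \<star> uniform_dirac F)"
    unfolding invariant_measure_def
  proof (rule the_equality)
    show "is_invariant_measure A B (lebesgue_01 \<star> uniform_dirac F)"
      by (fact inv)
    show "\<mu> = (lebesgue_01 \<star> uniform_dirac F)" if "is_invariant_measure A B \<mu>" for \<mu>
      using is_invariant_measure_unique[OF assms(1) _ _ that inv] fin nonempty
      by (simp add: B finite_digit_sums)
  qed
  moreover have "finite F" "F \<noteq> {}" "F \<subseteq> \<int>"
    using fin nonempty by (auto simp: F_def finite_digit_sums)
  ultimately show ?thesis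
    by blast
qed

end
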